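(* For every $n\in\mathbb{N}$, $$\sum_{k=0}^{2n}(-1)^kW_{k+1}\star G_{2n-k}=(-1)^n[2]_q^{2n}(yyxx)^ny=\sum_{k=0}^{2n}(-1)^kG_{2n-k}\star W_{k+1},$$ $$q^{-1}\sum_{k=0}^{2n+1}(-1)^kW_{k+1}\star G_{2n+1-k}=(-1)^n[2]_q^{2n+1}(yyxx)^nyyx=q\sum_{k=0}^{2n+1}(-1)^kG_{2n+1-k}\star W_{k+1}.$$
   Context: Let $\mathbb{F}$ be a field of characteristic zero and let $q\in\mathbb{F}$ be nonzero and not a root of unity; $\mathbb{N}=\{0,1,2,\ldots\}$; $[2]_q=q+q^{-1}$. Let $\mathbb{V}$ be the free associative unital $\mathbb{F}$-algebra on two noncommuting generators (letters) $x,y$; the words in $x,y$ (including the trivial word $\mathbf{1}$) form a basis of $\mathbb{V}$. Words such as $(xxyy)^nx$ are written with respect to the free (concatenation) product. The $q$-shuffle product $\star$ on the vector space $\mathbb{V}$ is the bilinear associative product with unit $\mathbf{1}$ determined as follows. Put $\langle x,x\rangle=\langle y,y\rangle=2$ and $\langle x,y\rangle=\langle y,x\rangle=-2$. For nontrivial words $u=u_1\cdots u_r$ and $v=v_1\cdots v_s$, $$u\star v=u_1\big((u_2\cdots u_r)\star v\big)+v_1\big(u\star(v_2\cdots v_s)\big)q^{\langle v_1,u_1\rangle+\cdots+\langle v_1,u_r\rangle}.$$ The alternating words are, for $n\in\mathbb{N}$ (powers in the free product): $\tilde{G}_{n+1}=(xy)^{n+1}$, $G_{n+1}=(yx)^{n+1}$,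 $W_{-n}=(xy)^nx$, $W_{n+1}=(yx)^ny$; also $G_0=\tilde{G}_0=\mathbf{1}$. *)

theory Defs
  imports Complex_Main "HOL-Library.Poly_Mapping"
begin

(* Lists form a monoid under concatenation. With this instance, the convolution product
   that Poly_Mapping puts on finitely supported functions on words is the free
   (concatenation) product, and *, ^ and 1 on the type free_alg below refer to it. *)

instantiation list :: (type) monoid_add
begin

definition zero_list :: "'a list" where "zero_list = []"

definition plus_list :: "'a list \<Rightarrow> 'a list \<Rightarrow> 'a list" where "plus_list = (@)"

instance
  by standard (simp_all add: zero_list_def plus_list_def)

end

datatype letter = LX | LY

type_synonym 'a free_alg = "letter list \<Rightarrow>\<^sub>0 'a"

abbreviation word :: "letter list \<Rightarrow> 'a::field free_alg" where
  "word w \<equiv> Poly_Mapping.single w 1"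

definition genx :: "'a::field free_alg" where "genx = word [LX]"

definition geny :: "'a::field free_alg" where "geny = word [LY]"

definition smult :: "'a::field \<Rightarrow> 'a free_alg \<Rightarrow> 'a free_alg" where
  "smult c p = Poly_Mapping.map (\<lambda>a. c * a) p"

definition pairing :: "letter \<Rightarrow> letter \<Rightarrow> int" where
  "pairing a b = (if a = b then 2 else -2)"

fun shuffle_words :: "'a::field \<Rightarrow> letter list \<Rightarrow> letter list \<Rightarrow> 'a free_alg" where
  "shuffle_words q [] v = word v"
| "shuffle_words q u [] = word u"
| "shuffle_words q (a # u) (b # v) =
     word [a] * shuffle_words q u (b # v)
     + smult (q powi (\<Sum>c\<leftarrow>a # u. pairing b c)) (word [b] * shuffle_words q (a # u) v)"

definition qshuffle :: "'a::field \<Rightarrow> 'a free_alg \<Rightarrow> 'a free_alg \<Rightarrow> 'a free_alg" where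
  "qshuffle q f g = (\<Sum>u\<in>Poly_Mapping.keys f. \<Sum>v\<in>Poly_Mapping.keys g.
     smult (Poly_Mapping.lookup f u * Poly_Mapping.lookup g v) (shuffle_words q u v))"

(* One family indexed by the integers: altW (-n) = (xy)^n x and altW (n + 1) = (yx)^n y
   for n in the natural numbers. *)

definition altW :: "int \<Rightarrow> 'a::field free_alg" where
  "altW i = (if i \<le> 0 then (genx * geny) ^ nat (- i) * genx
             else (geny * genx) ^ nat (i - 1) * geny)"

definition altG :: "nat \<Rightarrow> 'a::field free_alg" where
  "altG n = (geny * genx) ^ n"

definition qtwo :: "'a::field \<Rightarrow> 'a" where
  "qtwo q = q + inverse q"

lemma word_mult_word: "word u * word v = word (u @ v)"
  by (simp add: mult_single plus_list_def)

lemma lookup_smult [simp]: "Poly_Mapping.lookup (smult c p) w = c * Poly_Mapping.lookup p w"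
  by (simp add: smult_def map.rep_eq when_def)

lemma smult_add_left: "smult (c + d) p = smult c p + smult d p"
  by (rule poly_mapping_eqI) (simp add: lookup_add algebra_simps)

lemma smult_smult: "smult c (smult d p) = smult (c * d) p"
  by (rule poly_mapping_eqI) (simp add: algebra_simps)

lemma smult_zero [simp]: "smult 0 p = 0"
  by (rule poly_mapping_eqI) simp

lemma smult_one [simp]: "smult 1 p = p"
  by (rule poly_mapping_eqI) simp

lemma smult_add_right: "smult c (p + r) = smult c p + smult c r"
  by (rule poly_mapping_eqI) (simp add: lookup_add algebra_simps)

lemma smult_sum_right: "smult c (sum f A) = (\<Sum>i\<in>A. smult c (f i))"
  by (rule poly_mapping_eqI) (simp add: lookup_sum sum_distrib_left)

lemma shuffle_words_Nil_right [simp]: "shuffle_words q u [] = word u"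
  by (cases u) simp_all

lemma qshuffle_superset:
  assumes "finite A" "finite B" "Poly_Mapping.keys f \<subseteq> A" "Poly_Mapping.keys g \<subseteq> B"
  shows "qshuffle q f g = (\<Sum>u\<in>A. \<Sum>v\<in>B.
     smult (Poly_Mapping.lookup f u * Poly_Mapping.lookup g v) (shuffle_words q u v))"
proof -
  have "qshuffle q f g = (\<Sum>u\<in>Poly_Mapping.keys f. \<Sum>v\<in>B.
     smult (Poly_Mapping.lookup f u * Poly_Mapping.lookup g v) (shuffle_words q u v))"
    unfolding qshuffle_def using assms
    by (intro sum.cong refl sum.mono_neutral_left) (auto simp: in_keys_iff)
  also have "\<dots> = (\<Sum>u\<in>A. \<Sum>v\<in>B.
     smult (Poly_Mapping.lookup f u * Poly_Mapping.lookup g v) (shuffle_words q u v))"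
    using assms by (intro sum.mono_neutral_left) (auto simp: in_keys_iff)
  finally show ?thesis .
qed

lemma qshuffle_word_word: "qshuffle q (word u) (word v) = shuffle_words q u v"
  by (simp add: qshuffle_def)

lemma qshuffle_add_left: "qshuffle q (f + f') g = qshuffle q f g + qshuffle q f' g"
proof -
  let ?A = "Poly_Mapping.keys f \<union> Poly_Mapping.keys f'" and ?B = "Poly_Mapping.keys g"
  have "Poly_Mapping.keys (f + f') \<subseteq> ?A" by (rule Poly_Mapping.keys_add)
  then show ?thesis
    by (simp add: qshuffle_superset[of ?A ?B] lookup_add distrib_right smult_add_left
        sum.distrib)
qed

lemma qshuffle_add_right: "qshuffle q f (g + g') = qshuffle q f g + qshuffle q f g'"
proof -
  let ?B = "Poly_Mapping.keys g \<union> Poly_Mapping.keys g'" and ?A = "Poly_Mapping.keys f"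
  have "Poly_Mapping.keys (g + g') \<subseteq> ?B" by (rule Poly_Mapping.keys_add)
  then show ?thesis
    by (simp add: qshuffle_superset[of ?A ?B] lookup_add distrib_left smult_add_left
        sum.distrib)
qed

lemma qshuffle_smult_left: "qshuffle q (smult c f) g = smult c (qshuffle q f g)"
proof -
  have "Poly_Mapping.keys (smult c f) \<subseteq> Poly_Mapping.keys f"
    by (auto simp: in_keys_iff)
  then show ?thesis
    by (simp add: qshuffle_superset[of "Poly_Mapping.keys f" "Poly_Mapping.keys g"]
        smult_sum_right smult_smult mult.assoc)
qed

lemma qshuffle_smult_right: "qshuffle q f (smult c g) = smult c (qshuffle q f g)"
proof -
  have "Poly_Mapping.keys (smult c g) \<subseteq> Poly_Mapping.keys g"
    by (auto simp: in_keys_iff)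
  then show ?thesis
    by (simp add: qshuffle_superset[of "Poly_Mapping.keys f" "Poly_Mapping.keys g"]
        smult_sum_right smult_smult mult.left_commute)
qed

end

theory Submission
  imports Defs
begin

text \<open>
  Every product occurring in the recursive expansion of \<open>W\<^bsub>k+1\<^esub> \<star> G\<^bsub>m-k\<^esub>\<close> has
  alternating factors, the left one ending in \<open>y\<close> and the right one ending in \<open>x\<close>. Let \<open>S\<^sub>m\<close>,
  \<open>T\<^sub>m\<close>, \<open>E\<^sub>m\<close>, \<open>O\<^sub>m\<close> be the alternating sums of such products with lengths
  \<open>(2k+1, 2(m-k))\<close>, \<open>(2k, 2(m-k)+1)\<close>, \<open>(2k, 2(m-k))\<close>, \<open>(2k+1, 2(m-k)+1)\<close>. Splitting off first
  letters gives
  \<open>S\<^bsub>m+1\<^esub> = y (E\<^bsub>m+1\<^esub> + q\<^sup>2 O\<^sub>m)\<close>, \<open>T\<^bsub>m+1\<^esub> = x (E\<^bsub>m+1\<^esub> - O\<^sub>m)\<close>,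
  \<open>E\<^bsub>m+1\<^esub> = y T\<^sub>m - x S\<^sub>m\<close>, \<open>O\<^sub>m = y T\<^sub>m + q\<^bsup>-2\<^esup> x S\<^sub>m\<close>.
  The unwanted terms cancel, leaving \<open>S\<^bsub>m+1\<^esub> = (q\<^sup>2 + 1) yy T\<^sub>m\<close> and
  \<open>T\<^bsub>m+1\<^esub> = -(1 + q\<^bsup>-2\<^esup>) xx S\<^sub>m\<close>. The sums with the factors interchanged follow by the
  symmetry \<open>u \<star>\<^sub>q v = q\<^bsup>\<langle>u,v\<rangle>\<^esup> (v \<star>\<^bsub>1/q\<^esub> u)\<close>, since \<open>\<langle>W\<^bsub>k+1\<^esub>, G\<^bsub>m-k\<^esub>\<rangle> = 0\<close>.
\<close>

section \<open>Scalars in the free algebra\<close>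

lemma smult_minus_right: "smult c (- p) = - smult c p"
  by (rule poly_mapping_eqI) simp

lemma smult_minus_left: "smult (- c) p = - smult c p"
  by (rule poly_mapping_eqI) simp

lemma smult_diff_left: "smult (c - d) p = smult c p - smult d p"
  by (rule poly_mapping_eqI) (simp add: lookup_minus algebra_simps)

text \<open>Scaling is multiplication by a multiple of the empty word, which commutes with every
  word.\<close>

lemma mult_smult_right: "word w * smult c p = smult c (word w * p)"
proof -
  have scal: "smult c r = Poly_Mapping.single 0 c * r" for r :: "'a free_alg"
    by (simp add: smult_def mult_map_scale_conv_mult)
  have "word w * smult c p = (word w * Poly_Mapping.single 0 c) * p"
    by (simp add: scal mult.assoc)
  also have "word w * Poly_Mapping.single 0 c = Poly_Mapping.single 0 c * word w"
    by (simp add: mult_single)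
  finally show ?thesis
    by (simp add: scal mult.assoc)
qed

lemma genx_smult: "genx * smult c p = smult c (genx * p)"
  and geny_smult: "geny * smult c p = smult c (geny * p)"
  by (simp_all add: genx_def geny_def mult_smult_right)

lemmas smult_simps = smult_diff_left smult_add_right smult_add_left smult_smult smult_minus_right smult_minus_left
  genx_smult geny_smult distrib_left right_diff_distrib

section \<open>Symmetry of the shuffle product under inversion of \<open>q\<close>\<close>

definition weight_pairing :: "letter list \<Rightarrow> letter list \<Rightarrow> int" where
  "weight_pairing u v = (\<Sum>a\<leftarrow>u. \<Sum>b\<leftarrow>v. pairing a b)"

lemma pairing_commute: "pairing a b = pairing b a"
  by (simp add: pairing_def)

lemma weight_pairing_Cons_left:
  "weight_pairing (a # u) v = (\<Sum>b\<leftarrow>v. pairing a b) + weight_pairing u v"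
  by (simp add: weight_pairing_def)

lemma weight_pairing_Cons_right:
  "weight_pairing u (b # v) = (\<Sum>a\<leftarrow>u. pairing b a) + weight_pairing u v"
  by (simp add: weight_pairing_def sum_list_addf pairing_commute[of _ b])

lemma weight_pairing_Nil [simp]: "weight_pairing [] v = 0" "weight_pairing u [] = 0"
  by (simp_all add: weight_pairing_def)

text \<open>In the product with swapped factors, the recursion puts its weight on the other first
  letter. Splitting a first letter off either argument of \<open>weight_pairing\<close> reconciles
  the two exponents.\<close>

lemma shuffle_words_swap:
  assumes "q \<noteq> 0"
  shows "shuffle_words q u v = smult (q powi weight_pairing u v) (shuffle_words (inverse q) v u)"
  using assms
proof (induction q u v rule: shuffle_words.induct)
  case (3 q a u b v)
  let ?X = "word [a] * shuffle_words (inverse q) (b # v) u"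
  let ?Y = "word [b] * shuffle_words (inverse q) v (a # u)"
  let ?s = "\<Sum>c\<leftarrow>a # u. pairing b c" and ?t = "\<Sum>c\<leftarrow>b # v. pairing a c"
  have "q \<noteq> 0" by (rule 3(3))
  have q: "q powi (i + j) = q powi i * q powi j" for i j
    using \<open>q \<noteq> 0\<close> by (simp add: power_int_add)
  have w: "weight_pairing (a # u) (b # v) = ?s + weight_pairing (a # u) v"
    "weight_pairing (a # u) (b # v) = ?t + weight_pairing u (b # v)"
    by (rule weight_pairing_Cons_right, rule weight_pairing_Cons_left)
  have "shuffle_words q (a # u) (b # v) = smult (q powi weight_pairing u (b # v)) ?X
      + smult (q powi weight_pairing (a # u) (b # v)) ?Y"
    by (simp only: shuffle_words.simps(3) 3(1,2)[OF \<open>q \<noteq> 0\<close>] mult_smult_right smult_smult flip: q w(1))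
  moreover have "q powi weight_pairing u (b # v)
      = q powi weight_pairing (a # u) (b # v) * inverse q powi ?t"
    using \<open>q \<noteq> 0\<close> by (simp only: w(2) q power_int_inverse) simp
  ultimately show ?case
    by (simp only: shuffle_words.simps smult_add_right smult_smult add.commute)
qed simp_all

section \<open>Alternating words\<close>

definition flip :: "letter \<Rightarrow> letter" where
  "flip a = (if a = LX then LY else LX)"

text \<open>The last letter is \<open>a\<close>, so that tails of alternating words keep the parameter \<open>a\<close>.\<close>

fun alt_word :: "letter \<Rightarrow> nat \<Rightarrow> letter list" where
  "alt_word a 0 = []"
| "alt_word a (Suc n) = (if even n then a else flip a) # alt_word a n"

text \<open>Neighbouring letters are opposite, so their pairings with \<open>b\<close> cancel in
  pairs.\<close>

lemma pairing_sum_alt_word: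
  "(\<Sum>c\<leftarrow>alt_word a n. pairing b c) = (if odd n then pairing b a else 0)"
  by (induction n) (auto simp: pairing_def flip_def intro: letter.exhaust)

lemma altG_eq_word: "altG n = word (alt_word LX (2 * n))"
proof (induction n)
  case 0
  then show ?case by (simp add: altG_def one_poly_mapping_def flip: zero_list_def)
next
  case (Suc n)
  then show ?case
    by (simp add: altG_def genx_def geny_def word_mult_word mult.assoc flip_def)
qed

lemma altW_eq_word: "altW (int k + 1) = word (alt_word LY (2 * k + 1))"
proof -
  have "(geny * genx) ^ k * geny = (word (alt_word LY (2 * k + 1)) :: 'a free_alg)"
  proof (induction k)
    case (Suc k)
    then show ?case
      by (simp add: genx_def geny_def word_mult_word mult.assoc flip_def)
  qed (simp add: geny_def)
  then show ?thesis
    by (simp add: altW_def)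
qed

section \<open>Alternating convolution sums\<close>

definition conv :: "(nat \<Rightarrow> nat \<Rightarrow> 'b::comm_monoid_add) \<Rightarrow> nat \<Rightarrow> 'b" where
  "conv g m = (\<Sum>k\<le>m. g k (m - k))"

lemma conv_0 [simp]: "conv g 0 = g 0 0"
  by (simp add: conv_def)

lemma conv_cong: "(\<And>k j. k + j = m \<Longrightarrow> g k j = h k j) \<Longrightarrow> conv g m = conv h m"
  by (simp add: conv_def)

lemma conv_add: "conv (\<lambda>k j. g k j + h k j) m = conv g m + conv h m"
  by (simp add: conv_def sum.distrib)

lemma conv_minus: "conv (\<lambda>k j. - g k j) m = - conv (g :: nat \<Rightarrow> nat \<Rightarrow> 'b::ab_group_add) m"
  by (simp add: conv_def sum_negf)

lemma conv_mult_left: "conv (\<lambda>k j. p * g k j) m = p * conv (g :: nat \<Rightarrow> nat \<Rightarrow> 'b::semiring_0) m"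
  by (simp add: conv_def sum_distrib_left)

lemma conv_smult: "conv (\<lambda>k j. smult c (g k j)) m = smult c (conv g m)"
  by (simp add: conv_def smult_sum_right)

text \<open>The value 0 at index 0 stands for the missing term when a factor is empty and has no
  first letter.\<close>

lemma conv_Suc_left: "conv (\<lambda>k j. case k of 0 \<Rightarrow> 0 | Suc k' \<Rightarrow> g k' j) (Suc m) = conv g m"
  by (simp add: conv_def sum.atMost_Suc_shift del: sum.atMost_Suc)

lemma conv_Suc_right: "conv (\<lambda>k j. case j of 0 \<Rightarrow> 0 | Suc j' \<Rightarrow> g k j') (Suc m) = conv g m"
  by (simp add: conv_def Suc_diff_le)

text \<open>With \<open>(r, s)\<close> equal to (1,0), (0,1), (0,0), (1,1), the sums
  \<open>conv (alt_shuffle q r s) m\<close> are S, T, E, O at m.\<close>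

definition alt_shuffle :: "'a::field \<Rightarrow> nat \<Rightarrow> nat \<Rightarrow> nat \<Rightarrow> nat \<Rightarrow> 'a free_alg" where
  "alt_shuffle q r s k j =
    smult ((-1) ^ k) (shuffle_words q (alt_word LY (2 * k + r)) (alt_word LX (2 * j + s)))"

lemma word_letters:
  "word [] = 1" "word (LX # w) = genx * word w" "word (LY # w) = geny * word w"
  by (simp_all add: genx_def geny_def word_mult_word flip: single_one) (simp add: zero_list_def)

lemmas shuffle_alt_simps = pairing_sum_alt_word pairing_def flip_def alt_shuffle_def
  power_int_minus smult_simps word_letters mult_smult_right

section \<open>First-letter recurrences\<close>

lemma alt_shuffle_1_0:
  "alt_shuffle q 1 0 k j = geny * alt_shuffle q 0 0 k j
    + (case j of 0 \<Rightarrow> 0 | Suc j' \<Rightarrow> smult (q\<^sup>2) (geny * alt_shuffle q 1 1 k j'))"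
  by (cases j) (simp_all add: shuffle_alt_simps mult_ac)

lemma alt_shuffle_1_1:
  "alt_shuffle q 1 1 k j = geny * alt_shuffle q 0 1 k j
    + smult (inverse (q\<^sup>2)) (genx * alt_shuffle q 1 0 k j)"
  by (simp add: shuffle_alt_simps mult_ac)

text \<open>Shortening a left word of even length lowers \<open>k\<close>, whence the minus
  sign.\<close>

lemma alt_shuffle_0_1:
  "alt_shuffle q 0 1 k j = genx * alt_shuffle q 0 0 k j
    + (case k of 0 \<Rightarrow> 0 | Suc k' \<Rightarrow> - (genx * alt_shuffle q 1 1 k' j))"
  by (cases k) (simp_all add: shuffle_alt_simps)

text \<open>At \<open>k = j = 0\<close> the left side is 1 and the right side 0.\<close>

lemma alt_shuffle_0_0:
  assumes "k + j > 0"
  shows "alt_shuffle q 0 0 k j =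
    (case j of 0 \<Rightarrow> 0 | Suc j' \<Rightarrow> geny * alt_shuffle q 0 1 k j')
    + (case k of 0 \<Rightarrow> 0 | Suc k' \<Rightarrow> - (genx * alt_shuffle q 1 0 k' j))"
  using assms by (cases k; cases j) (simp_all add: shuffle_alt_simps)

lemma conv_alt_shuffle_1_1:
  "conv (alt_shuffle q 1 1) m = geny * conv (alt_shuffle q 0 1) m
    + smult (inverse (q\<^sup>2)) (genx * conv (alt_shuffle q 1 0) m)"
  by (subst conv_cong[OF alt_shuffle_1_1]) (simp add: conv_add conv_smult conv_mult_left)

lemma conv_alt_shuffle_0_0:
  "conv (alt_shuffle q 0 0) (Suc m) = geny * conv (alt_shuffle q 0 1) m
    - genx * conv (alt_shuffle q 1 0) m"
  by (subst conv_cong[OF alt_shuffle_0_0])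
    (simp_all add: conv_add conv_Suc_left conv_Suc_right conv_mult_left conv_minus)

lemma conv_alt_shuffle_1_0:
  assumes "q \<noteq> 0"
  shows "conv (alt_shuffle q 1 0) (Suc m)
    = smult (q\<^sup>2 + 1) (geny * geny * conv (alt_shuffle q 0 1) m)"
proof -
  have "conv (alt_shuffle q 1 0) (Suc m)
      = geny * (conv (alt_shuffle q 0 0) (Suc m) + smult (q\<^sup>2) (conv (alt_shuffle q 1 1) m))"
    by (subst conv_cong[OF alt_shuffle_1_0])
      (simp add: conv_add conv_Suc_right conv_mult_left conv_smult smult_simps del: One_nat_def)
  \<comment> \<open>The terms in \<open>genx * conv (alt_shuffle q 1 0) m\<close> cancel because
    \<open>q\<^sup>2 * inverse (q\<^sup>2) = 1\<close>.\<close>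
  then show ?thesis
    using assms
    by (simp add: conv_alt_shuffle_0_0 conv_alt_shuffle_1_1 smult_simps mult.assoc del: One_nat_def)
qed

lemma conv_alt_shuffle_0_1:
  "conv (alt_shuffle q 0 1) (Suc m)
    = smult (- (1 + inverse (q\<^sup>2))) (genx * genx * conv (alt_shuffle q 1 0) m)"
proof -
  have "conv (alt_shuffle q 0 1) (Suc m)
      = genx * (conv (alt_shuffle q 0 0) (Suc m) - conv (alt_shuffle q 1 1) m)"
    by (subst conv_cong[OF alt_shuffle_0_1])
      (simp add: conv_add conv_Suc_left conv_mult_left conv_minus smult_simps del: One_nat_def)
  then show ?thesis
    by (simp add: conv_alt_shuffle_0_0 conv_alt_shuffle_1_1 smult_simps mult.assoc del: One_nat_def)
qed

lemma conv_alt_shuffle_closed_form: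
  assumes "q \<noteq> 0"
  shows "conv (alt_shuffle q 1 0) (2 * n)
      = smult ((-1) ^ n * qtwo q ^ (2 * n)) ((geny * geny * genx * genx) ^ n * geny)"
    and "conv (alt_shuffle q 1 0) (2 * n + 1)
      = smult (q * ((-1) ^ n * qtwo q ^ (2 * n + 1)))
          ((geny * geny * genx * genx) ^ n * geny * geny * genx)"
proof -
  have base: "conv (alt_shuffle q 1 0) 0 = geny" "conv (alt_shuffle q 0 1) 0 = genx"
    by (simp_all add: alt_shuffle_def genx_def geny_def)
  \<comment> \<open>This is the scalar gained by two recurrence steps, which together prepend
    yyxx.\<close>
  have qtwo_sq: "(q\<^sup>2 + 1) * - (1 + inverse (q\<^sup>2)) = - (qtwo q)\<^sup>2"
    using assms by (simp add: qtwo_def field_simps power2_eq_square)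
  have step: "conv (alt_shuffle q 1 0) (Suc (Suc m))
      = smult (- (qtwo q)\<^sup>2) (geny * geny * genx * genx * conv (alt_shuffle q 1 0) m)" for m
    by (simp only: conv_alt_shuffle_1_0[OF assms] conv_alt_shuffle_0_1 genx_smult geny_smult smult_smult
        mult.assoc qtwo_sq)
  have iterate: "conv (alt_shuffle q 1 0) (2 * n + r)
      = smult ((-1) ^ n * qtwo q ^ (2 * n))
          ((geny * geny * genx * genx) ^ n * conv (alt_shuffle q 1 0) r)" for r
    by (induction n) (simp_all add: step smult_simps mult_ac power2_eq_square del: One_nat_def)
  show "conv (alt_shuffle q 1 0) (2 * n)
      = smult ((-1) ^ n * qtwo q ^ (2 * n)) ((geny * geny * genx * genx) ^ n * geny)"
    using iterate[of 0] by (simp only: base add_0_right)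
  \<comment> \<open>The odd case starts from one step of the recurrence, whose scalar leaves an
    extra factor \<open>q\<close>.\<close>
  have qtwo_mult: "q\<^sup>2 + 1 = q * qtwo q"
    using assms by (simp add: qtwo_def field_simps power2_eq_square)
  have one: "conv (alt_shuffle q 1 0) (Suc 0) = smult (q * qtwo q) (geny * geny * genx)"
    by (simp only: conv_alt_shuffle_1_0[OF assms] base qtwo_mult)
  have "(geny * geny * genx * genx) ^ n * smult (q * qtwo q) (geny * geny * genx)
      = smult (q * qtwo q) ((geny * geny * genx * genx) ^ n * geny * geny * genx)"
    by (induction n) (simp_all add: smult_simps mult.assoc)
  then show "conv (alt_shuffle q 1 0) (2 * n + 1)
      = smult (q * ((-1) ^ n * qtwo q ^ (2 * n + 1)))
          ((geny * geny * genx * genx) ^ n * geny * geny * genx)"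
    using iterate[of 1] one by (simp add: smult_smult mult_ac)
qed

section \<open>Transfer to the stated sums\<close>

lemma sum_qshuffle_altW_altG:
  "(\<Sum>k=0..m. smult ((-1) ^ k) (qshuffle q (altW (int k + 1)) (altG (m - k))))
    = conv (alt_shuffle q 1 0) m"
  by (simp only: conv_def alt_shuffle_def altW_eq_word altG_eq_word qshuffle_word_word
      atLeast0AtMost add_0_right)

text \<open>The word of \<open>altG j\<close> has as many x as y, so it pairs to 0 with every word
  and the swap factor is 1.\<close>

lemma qshuffle_altG_altW:
  assumes "q \<noteq> 0"
  shows "qshuffle q (altG j) (altW (int k + 1)) = qshuffle (inverse q) (altW (int k + 1)) (altG j)"
proof -
  have "weight_pairing (alt_word LX (2 * j)) v = 0" for v
    by (induction v) (simp_all add: weight_pairing_Cons_right pairing_sum_alt_word)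
  then show ?thesis
    by (simp only: altW_eq_word altG_eq_word qshuffle_word_word
        shuffle_words_swap[OF assms, of "alt_word LX (2 * j)"] power_int_0_right smult_one)
qed

lemma qtwo_inverse: "qtwo (inverse q) = qtwo q"
  by (simp add: qtwo_def add.commute)

theorem proposition5p8:
  fixes q :: "'a::field_char_0" and n :: nat
  assumes "q \<noteq> 0"
    and "\<And>m::nat. m > 0 \<Longrightarrow> q ^ m \<noteq> 1"
  shows "((\<Sum>k=0..2*n. smult ((-1) ^ k) (qshuffle q (altW (int k + 1)) (altG (2*n - k))))
           = smult ((-1) ^ n * qtwo q ^ (2*n)) ((geny * geny * genx * genx) ^ n * geny)) \<and>
         (smult ((-1) ^ n * qtwo q ^ (2*n)) ((geny * geny * genx * genx) ^ n * geny)
           = (\<Sum>k=0..2*n. smult ((-1) ^ k) (qshuffle q (altG (2*n - k)) (altW (int k + 1))))) \<and>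
         (smult (inverse q)
             (\<Sum>k=0..2*n+1. smult ((-1) ^ k) (qshuffle q (altW (int k + 1)) (altG (2*n + 1 - k))))
           = smult ((-1) ^ n * qtwo q ^ (2*n + 1))
               ((geny * geny * genx * genx) ^ n * geny * geny * genx)) \<and>
         (smult ((-1) ^ n * qtwo q ^ (2*n + 1))
               ((geny * geny * genx * genx) ^ n * geny * geny * genx)
           = smult q
             (\<Sum>k=0..2*n+1. smult ((-1) ^ k) (qshuffle q (altG (2*n + 1 - k)) (altW (int k + 1)))))"
proof -
  have swap: "(\<Sum>k=0..m. smult ((-1) ^ k) (qshuffle q (altG (m - k)) (altW (int k + 1))))
      = conv (alt_shuffle (inverse q) 1 0) m" for m
    by (simp only: qshuffle_altG_altW[OF assms(1)] sum_qshuffle_altW_altG)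
  have "inverse q \<noteq> 0"
    using assms(1) by simp
  note closed = conv_alt_shuffle_closed_form[OF assms(1)]
    conv_alt_shuffle_closed_form[OF \<open>inverse q \<noteq> 0\<close>]
  \<comment> \<open>The odd closed forms carry the factor \<open>q\<close> for one order and
    \<open>inverse q\<close> for the other; the outer scalars remove it.\<close>
  have cancel: "inverse q * (q * c) = c" "q * (inverse q * c) = c" for c
    using assms(1) by (simp_all flip: mult.assoc)
  show ?thesis
    by (simp only: swap sum_qshuffle_altW_altG closed qtwo_inverse smult_smult cancel simp_thms)
qed

end
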